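(* For every (even) integer $n \geq 0$ there exists a constant $c_n > 0$, depending only on $n$, such that for every continuous function $f:\mathbb{T} \rightarrow \mathbb{R}$, not identically zero, having $n$ sign changes, $$\sum_{k=0}^{n/2} \Big( \left|\left\langle f, \sin kx \right\rangle\right| + \left|\left\langle f, \cos kx\right\rangle\right| \Big) \geq c_n \frac{\|f\|_{L^1(\mathbb{T})}^{n+1}}{\|f\|_{L^\infty(\mathbb{T})}^{n}}.$$
   Context: $\mathbb{T} = \mathbb{R}/2\pi\mathbb{Z}$ is the circle of length $2\pi$ and $\langle f, g\rangle = \int_0^{2\pi} f(x) g(x)\,dx$. The number of sign changes of a continuous $f:\mathbb{T}\to\mathbb{R}$ is the largest $n$ for which there are points $x_1, \dots, x_n$ in cyclic order on $\mathbb{T}$ such that $f$ takes nonzero values of opposite sign at any two cyclically consecutive points (including the pair $x_n, x_1$), and it is $0$ if no such points exist; on the circle this number, when finite, is even. Zeros at which $f$ does not change sign are not counted. *)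

theory Defs
  imports "HOL-Analysis.Analysis" "HOL-Probability.Essential_Supremum" "HOL-Library.Extended_Nat"
begin

text \<open>
  Functions on the circle \<open>\<real> / 2\<pi>\<int>\<close> are represented by \<open>2\<pi>\<close>-periodic functions on the real line.
\<close>

definition circle_fun :: "(real \<Rightarrow> real) \<Rightarrow> bool" where
  "circle_fun f \<longleftrightarrow> (\<forall>x. f (x + 2 * pi) = f x)"

abbreviation circle_measure :: "real measure" where
  "circle_measure \<equiv> lebesgue_on {0..2 * pi}"

definition circle_inner :: "(real \<Rightarrow> real) \<Rightarrow> (real \<Rightarrow> real) \<Rightarrow> real" where
  "circle_inner f g = (\<integral>x. f x * g x \<partial>circle_measure)"

definition L1_norm :: "(real \<Rightarrow> real) \<Rightarrow> real" where
  "L1_norm f = (\<integral>x. \<bar>f x\<bar> \<partial>circle_measure)"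

definition Linf_norm :: "(real \<Rightarrow> real) \<Rightarrow> real" where
  "Linf_norm f = real_of_ereal (esssup circle_measure (\<lambda>x. ereal \<bar>f x\<bar>))"

text \<open>
  A cyclically ordered tuple of points of the circle is given by lifts
  \<open>x 0 < x 1 < \<dots> < x (m - 1) < x 0 + 2\<pi>\<close>. Since indices are taken modulo \<open>m\<close>, the sign condition
  includes the pair of the last and the first point. The value \<open>m = 0\<close> is always
  admissible and \<open>m = 1\<close> never is.
\<close>

definition alternating_points :: "(real \<Rightarrow> real) \<Rightarrow> nat \<Rightarrow> (nat \<Rightarrow> real) \<Rightarrow> bool" where
  "alternating_points f m x \<longleftrightarrow>
     strict_mono_on {..<m} x \<and>
     (\<forall>i<m. x i < x 0 + 2 * pi) \<and>
     (\<forall>i<m. f (x i) * f (x (Suc i mod m)) < 0)"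

text \<open>
  The supremum is over a nonempty set of extended naturals, so it is a maximum whenever it is
  finite; it is \<open>\<infinity>\<close> if there are arbitrarily long alternating tuples.
\<close>

definition sign_changes :: "(real \<Rightarrow> real) \<Rightarrow> enat" where
  "sign_changes f = Sup {enat m | m. \<exists>x. alternating_points f m x}"

end

theory Submission
  imports Defs
begin

text \<open>
  If \<open>f\<close> changes sign exactly at \<open>t\<^sub>0, \<dots>, t\<^bsub>n-1\<^esub>\<close>, then \<open>p x = \<Prod>i<n. sin ((t\<^sub>i - x) / 2)\<close>
  is, since \<open>n\<close> is even, a trigonometric polynomial of degree \<open>n / 2\<close>, and \<open>f p\<close> has constant sign.
  Hence the low Fourier coefficients of \<open>f\<close> control \<open>\<integral> \<bar>f p\<bar>\<close>. Conversely \<open>\<bar>p\<bar> \<ge> \<epsilon>\<^sup>n\<close> off a set of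
  measure at most \<open>6 \<pi> n \<epsilon>\<close>, so that \<open>\<integral> \<bar>f p\<bar> \<ge> \<epsilon>\<^sup>n (\<parallel>f\<parallel>\<^sub>1 - 6 \<pi> n \<epsilon> \<parallel>f\<parallel>\<^sub>\<infinity>)\<close>; the choice of \<open>\<epsilon>\<close>
  as a small multiple of \<open>\<parallel>f\<parallel>\<^sub>1 / \<parallel>f\<parallel>\<^sub>\<infinity>\<close> gives the claim.
\<close>

section \<open>Low Fourier coefficients and products of half-angle sines\<close>

lemma integrable_circle_continuous:
  fixes g :: "real \<Rightarrow> real"
  assumes "continuous_on UNIV g"
  shows "integrable circle_measure g"
  by (rule continuous_imp_integrable_real) (rule continuous_on_subset[OF assms subset_UNIV])

text \<open>The half angle gives each factor exactly one zero per turn of the circle, with a sign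
  change there. A single factor is only \<open>2 * pi\<close>-antiperiodic, so the product lives on
  the circle when \<open>n\<close> is even. With \<open>t i - x\<close> instead of
  \<open>x - t i\<close> a factor is positive just before its zero.\<close>

definition half_sines :: "nat \<Rightarrow> (nat \<Rightarrow> real) \<Rightarrow> real \<Rightarrow> real" where
  "half_sines n t x = (\<Prod>i<n. sin ((t i - x) / 2))"

text \<open>Product-to-sum applied twice: two half-angle sines give a constant and one cosine in
  \<open>x\<close>, and multiplying by the outer cosine moves its frequency by at most 1. The free
  phase \<open>\<phi>\<close> absorbs all shifts, and sines along with them.\<close>

lemma half_sines_Suc_Suc_cos:
  "half_sines (Suc (Suc n)) t x * cos (a * x + \<phi>) =
     (cos ((t n - t (Suc n)) / 2) / 2) * (half_sines n t x * cos (a * x + \<phi>))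
     - 1/4 * (half_sines n t x * cos ((a + 1) * x + (\<phi> - (t n + t (Suc n)) / 2)))
     - 1/4 * (half_sines n t x * cos ((a - 1) * x + (\<phi> + (t n + t (Suc n)) / 2)))"
proof -
  have *: "sin ((u - x) / 2) * sin ((v - x) / 2) * cos w =
      cos ((u - v) / 2) / 2 * cos w - 1/4 * cos (w + (x - (u + v) / 2)) - 1/4 * cos (w - (x - (u + v) / 2))"
    for u v w :: real
  proof -
    have a: "(u - x) / 2 - (v - x) / 2 = (u - v) / 2"
      "(u - x) / 2 + (v - x) / 2 = - (x - (u + v) / 2)" by (simp_all add: field_simps)
    have "sin ((u - x) / 2) * sin ((v - x) / 2) = (cos ((u - v) / 2) - cos (x - (u + v) / 2)) / 2"
      by (simp only: sin_times_sin a cos_minus)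
    moreover have "cos (w + (x - (u + v) / 2)) + cos (w - (x - (u + v) / 2)) = 2 * (cos w * cos (x - (u + v) / 2))"
      by (simp add: cos_add cos_diff)
    ultimately show ?thesis
      by algebra
  qed
  have b: "(a + 1) * x + (\<phi> - (t n + t (Suc n)) / 2) = (a * x + \<phi>) + (x - (t n + t (Suc n)) / 2)"
    "(a - 1) * x + (\<phi> + (t n + t (Suc n)) / 2) = (a * x + \<phi>) - (x - (t n + t (Suc n)) / 2)"
    by (simp_all add: field_simps)
  have "half_sines (Suc (Suc n)) t x * cos (a * x + \<phi>) =
     half_sines n t x * (sin ((t n - x) / 2) * sin ((t (Suc n) - x) / 2) * cos (a * x + \<phi>))"
    by (simp add: half_sines_def mult_ac)
  then show ?thesis
    unfolding * b by (simp add: algebra_simps)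
qed

lemma continuous_on_half_sines [continuous_intros]: "continuous_on S (half_sines n t)"
  unfolding half_sines_def by (intro continuous_intros) auto

text \<open>
  Including the factor \<open>cos (k x + \<phi>)\<close> makes the induction go through with constant 1: two further
  half-angle sines turn it into a combination of such factors whose weights sum to at most 1.
\<close>

lemma inner_half_sines_cos_le:
  fixes k :: int
  assumes f: "continuous_on UNIV f" and "\<bar>k\<bar> + int j \<le> int m"
  shows "\<bar>circle_inner f (\<lambda>x. half_sines (2 * j) t x * cos (of_int k * x + \<phi>))\<bar>
    \<le> (\<Sum>k = 0..m. \<bar>circle_inner f (\<lambda>x. sin (real k * x))\<bar> + \<bar>circle_inner f (\<lambda>x. cos (real k * x))\<bar>)"
    (is "_ \<le> ?S")
  using assms(2)
proof (induction j arbitrary: k \<phi>)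
  case 0
  \<comment> \<open>The recursion lowers frequencies below zero, whereas the sum runs over natural
    ones; parity of sine and cosine reduces \<open>k\<close> to \<open>K\<close> at the cost of the
    sign \<open>?s\<close>.\<close>
  define K where "K = nat \<bar>k\<bar>"
  let ?s = "if k < 0 then -1 else 1 :: real"
  have K: "of_int k = ?s * real K" by (simp add: K_def)
  have sc: "sin (of_int k * x) = ?s * sin (real K * x)" "cos (of_int k * x) = cos (real K * x)" for x
    unfolding K by auto
  have int: "integrable circle_measure (\<lambda>x. f x * cos (real K * x))"
    "integrable circle_measure (\<lambda>x. f x * sin (real K * x))"
    by (intro integrable_circle_continuous continuous_intros f)+
  have "circle_inner f (\<lambda>x. half_sines (2 * 0) t x * cos (of_int k * x + \<phi>)) =
     (\<integral>x. cos \<phi> * (f x * cos (real K * x)) - ?s * sin \<phi> * (f x * sin (real K * x)) \<partial>circle_measure)"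
    unfolding circle_inner_def half_sines_def cos_add sc
    by (intro Bochner_Integration.integral_cong) (auto simp: algebra_simps)
  also have "\<dots> = cos \<phi> * circle_inner f (\<lambda>x. cos (real K * x)) - ?s * sin \<phi> * circle_inner f (\<lambda>x. sin (real K * x))"
    using int unfolding circle_inner_def
    by (subst Bochner_Integration.integral_diff) auto
  finally have "\<bar>circle_inner f (\<lambda>x. half_sines (2 * 0) t x * cos (of_int k * x + \<phi>))\<bar>
      \<le> \<bar>cos \<phi>\<bar> * \<bar>circle_inner f (\<lambda>x. cos (real K * x))\<bar> + \<bar>sin \<phi>\<bar> * \<bar>circle_inner f (\<lambda>x. sin (real K * x))\<bar>"
    by (simp only:, intro order_trans[OF abs_triangle_ineq4]) (auto simp: abs_mult)
  also have "\<dots> \<le> 1 * \<bar>circle_inner f (\<lambda>x. cos (real K * x))\<bar> + 1 * \<bar>circle_inner f (\<lambda>x. sin (real K * x))\<bar>"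
    by (intro add_mono mult_right_mono) auto
  also have "\<dots> \<le> ?S"
    using member_le_sum[of K "{0..m}" "\<lambda>k. \<bar>circle_inner f (\<lambda>x. sin (real k * x))\<bar> + \<bar>circle_inner f (\<lambda>x. cos (real k * x))\<bar>"]
      0 by (simp add: K_def add.commute)
  finally show ?case .
next
  case (Suc j)
  let ?u = "t (2 * j)" and ?v = "t (Suc (2 * j))"
  let ?I = "\<lambda>k \<phi>. circle_inner f (\<lambda>x. half_sines (2 * j) t x * cos (of_int k * x + \<phi>))"
  have int: "integrable circle_measure (\<lambda>x. f x * (half_sines (2 * j) t x * cos (of_int k * x + \<phi>)))" for k \<phi>
    by (intro integrable_circle_continuous continuous_intros f)
  have e: "real_of_int k + 1 = of_int (k + 1)" "real_of_int k - 1 = of_int (k - 1)" by auto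
  have "circle_inner f (\<lambda>x. half_sines (2 * Suc j) t x * cos (of_int k * x + \<phi>)) =
     (\<integral>x. (cos ((?u - ?v) / 2) / 2) * (f x * (half_sines (2 * j) t x * cos (of_int k * x + \<phi>)))
     - 1/4 * (f x * (half_sines (2 * j) t x * cos (of_int (k + 1) * x + (\<phi> - (?u + ?v) / 2))))
     - 1/4 * (f x * (half_sines (2 * j) t x * cos (of_int (k - 1) * x + (\<phi> + (?u + ?v) / 2)))) \<partial>circle_measure)"
    unfolding circle_inner_def mult_Suc_right add_2_eq_Suc half_sines_Suc_Suc_cos e
    by (intro Bochner_Integration.integral_cong) (simp_all add: algebra_simps)
  also have "\<dots> = (cos ((?u - ?v) / 2) / 2) * ?I k \<phi> - 1/4 * ?I (k + 1) (\<phi> - (?u + ?v) / 2)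
      - 1/4 * ?I (k - 1) (\<phi> + (?u + ?v) / 2)"
    using int unfolding circle_inner_def
    by (simp only: Bochner_Integration.integral_diff Bochner_Integration.integrable_diff
        integrable_mult_right integral_mult_right_zero)
  finally have "\<bar>circle_inner f (\<lambda>x. half_sines (2 * Suc j) t x * cos (of_int k * x + \<phi>))\<bar>
      \<le> \<bar>cos ((?u - ?v) / 2) / 2 * ?I k \<phi>\<bar> + 1/4 * \<bar>?I (k + 1) (\<phi> - (?u + ?v) / 2)\<bar>
      + 1/4 * \<bar>?I (k - 1) (\<phi> + (?u + ?v) / 2)\<bar>"
    by linarith
  also have "\<dots> \<le> 1/2 * ?S + 1/4 * ?S + 1/4 * ?S"
  proof -
    \<comment> \<open>Removing one pair of factors frees one unit of the budget \<open>m\<close>,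
      which pays for the change of \<open>k\<close> by 1.\<close>
    have "\<bar>?I k \<phi>\<bar> \<le> ?S" "\<bar>?I (k + 1) (\<phi> - (?u + ?v) / 2)\<bar> \<le> ?S" "\<bar>?I (k - 1) (\<phi> + (?u + ?v) / 2)\<bar> \<le> ?S"
      by (rule Suc.IH, use Suc.prems in linarith)+
    moreover have "\<bar>cos ((?u - ?v) / 2) / 2 * ?I k \<phi>\<bar> \<le> 1/2 * \<bar>?I k \<phi>\<bar>"
    proof -
      have "\<bar>cos ((?u - ?v) / 2)\<bar> * \<bar>?I k \<phi>\<bar> \<le> 1 * \<bar>?I k \<phi>\<bar>"
        by (rule mult_right_mono[OF abs_cos_le_one abs_ge_zero])
      then show ?thesis unfolding abs_mult abs_divide by (simp only: abs_numeral times_divide_eq_left)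
    qed
    ultimately show ?thesis by linarith
  qed
  finally show ?case by simp
qed

section \<open>Alternating tuples and the location of the sign changes\<close>

text \<open>The tuple length 0 is always admissible, and a nonempty set of extended naturals with
  finite supremum is finite, so the supremum is a maximum.\<close>

lemma sign_changes_eq_enatD:
  assumes "sign_changes f = enat n"
  shows "\<exists>x. alternating_points f n x" "alternating_points f m x \<Longrightarrow> m \<le> n"
proof -
  let ?A = "{enat m | m. \<exists>x. alternating_points f m x}"
  have S: "Sup ?A = enat n" using assms by (simp add: sign_changes_def)
  have ne: "?A \<noteq> {}" by (auto simp: alternating_points_def intro!: exI[of _ 0])
  have fin: "finite ?A" using S ne by (auto simp: Sup_enat_def split: if_splits)
  have "Max ?A \<in> ?A" by (rule Max_in[OF fin ne])
  moreover have "Max ?A = enat n" using S unfolding Sup_enat_def if_not_P[OF ne] if_P[OF fin] .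
  ultimately have "enat n \<in> ?A" by simp
  then show "\<exists>x. alternating_points f n x" by auto
  assume "alternating_points f m x"
  then have "enat m \<le> Sup ?A" by (intro Sup_upper) auto
  then show "m \<le> n" using S by simp
qed

text \<open>Compares every sign with that of \<open>f (x 0)\<close> rather than with the
  neighbouring one, the form in which tuples are extended below.\<close>

lemma alternating_points_signD:
  assumes "alternating_points f n x" and "i < n"
  shows "f (x 0) * (-1) ^ i * f (x i) > 0"
  using assms(2)
proof (induction i)
  case 0
  then show ?case using assms(1) by (auto simp: alternating_points_def zero_less_mult_iff mult_less_0_iff)
next
  case (Suc i)
  have "f (x i) * f (x (Suc i)) < 0"
    using assms(1) Suc.prems unfolding alternating_points_def by (metis Suc_lessD mod_less)
  moreover have "0 < f (x 0) * (-1) ^ i * f (x i)" using Suc by simp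
  ultimately show ?case by (auto simp: zero_less_mult_iff mult_less_0_iff)
qed

lemma alternating_pointsI:
  assumes "even n" and "strict_mono_on {..<n} x" and "\<And>i. i < n \<Longrightarrow> x i < x 0 + 2 * pi"
    and s: "\<And>i. i < n \<Longrightarrow> s * (-1) ^ i * f (x i) > (0::real)"
  shows "alternating_points f n x"
  unfolding alternating_points_def
proof (intro conjI allI impI assms)
  fix i assume i: "i < n"
  have "s * (-1) ^ (Suc i mod n) * f (x (Suc i mod n)) > 0"
    using i by (intro s) auto
  \<comment> \<open>At the wrap-around the index returns to 0 and the sign must flip there too,
    which is where evenness of \<open>n\<close> enters.\<close>
  moreover have "(-1) ^ (Suc i mod n) = - ((-1) ^ i :: real)"
  proof (cases "Suc i < n")
    case False
    then have "Suc i = n" using i by simp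
    then show ?thesis using assms(1) by auto
  qed simp
  ultimately have "- (s * (-1) ^ i * f (x (Suc i mod n))) > 0" by simp
  with s[OF i] show "f (x i) * f (x (Suc i mod n)) < 0"
    by (auto simp: zero_less_mult_iff mult_less_0_iff)
qed

lemma periodic_int:
  fixes g :: "real \<Rightarrow> 'a"
  assumes "\<And>x. g (x + c) = g x"
  shows "g (x + of_int k * c) = g x"
proof -
  have nat: "g (x + real m * c) = g x" for m x
  proof (induction m)
    case (Suc m)
    have "g (x + real (Suc m) * c) = g (x + real m * c + c)" by (simp add: algebra_simps)
    then show ?case using Suc assms by simp
  qed simp
  show ?thesis
  proof (cases "k \<ge> 0")
    case True
    then show ?thesis using nat[of x "nat k"] by simp
  next
    case False
    then show ?thesis using nat[of "x + of_int k * c" "nat (- k)"] by simp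
  qed
qed

lemma shift_into_period:
  fixes x a c :: real
  assumes "c > 0"
  obtains k :: int where "a \<le> x + of_int k * c" "x + of_int k * c < a + c"
proof -
  have "of_int \<lfloor>(x - a) / c\<rfloor> * c \<le> (x - a) / c * c" "(x - a) / c * c < (of_int \<lfloor>(x - a) / c\<rfloor> + 1) * c"
    using assms by (intro mult_right_mono mult_strict_right_mono; linarith)+
  moreover have "(x - a) / c * c = x - a" using assms by simp
  ultimately have "a \<le> x + of_int (- \<lfloor>(x - a) / c\<rfloor>) * c" "x + of_int (- \<lfloor>(x - a) / c\<rfloor>) * c < a + c"
    unfolding distrib_right of_int_minus by linarith+
  then show ?thesis by (rule that)
qed

text \<open>Each factor changes sign under a full turn, and an even number of sign changes
  cancels.\<close>

lemma half_sines_periodic: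
  assumes "even n"
  shows "half_sines n t (x + 2 * pi) = half_sines n t x"
proof -
  have "sin ((t i - (x + 2 * pi)) / 2) = - 1 * sin ((t i - x) / 2)" for i
  proof -
    have "(t i - (x + 2 * pi)) / 2 = (t i - x) / 2 - pi" by (simp add: field_simps)
    then show ?thesis by (simp only: sin_diff) simp
  qed
  then have "half_sines n t (x + 2 * pi) = (\<Prod>i<n. - 1 * sin ((t i - x) / 2))"
    unfolding half_sines_def by presburger
  also have "\<dots> = half_sines n t x"
    unfolding prod.distrib half_sines_def using assms by simp
  finally show ?thesis .
qed

lemma between_consecutive:
  fixes X :: "nat \<Rightarrow> real"
  assumes "n > 0" "X 0 \<le> u" "u \<le> X n"
  shows "\<exists>j<n. X j \<le> u \<and> u \<le> X (Suc j)"
  using assms(1,3)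
proof (induction n)
  case (Suc n)
  show ?case
  proof (cases "n > 0 \<and> u \<le> X n")
    case True
    then show ?thesis using Suc.IH less_Suc_eq by blast
  next
    case False
    then have "X n \<le> u" using assms(2) by auto
    then show ?thesis using Suc.prems by blast
  qed
qed simp

text \<open>Factors with index below \<open>j\<close> are nonpositive at \<open>x\<close> and those
  above are nonnegative. Their absolute values are collected in \<open>r\<close>, which leaves
  factor \<open>j\<close> as the only one of open sign.\<close>

lemma sign_half_sines:
  assumes "j < n" "\<And>i. i < j \<Longrightarrow> t i \<le> x \<and> x \<le> t i + 2 * pi"
    and "\<And>i. j < i \<Longrightarrow> i < n \<Longrightarrow> x \<le> t i \<and> t i \<le> x + 2 * pi"
  obtains r where "r \<ge> 0" "half_sines n t x = (-1) ^ j * r * sin ((t j - x) / 2)"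
proof
  let ?s = "\<lambda>i. sin ((t i - x) / 2)"
  let ?r = "(\<Prod>i<j. - ?s i) * (\<Prod>i\<in>{Suc j..<n}. ?s i)"
  have s1: "- ?s i \<ge> 0" if "i < j" for i
    unfolding sin_minus[symmetric] by (rule sin_ge_zero) (use assms(2)[OF that] in \<open>simp_all add: field_simps\<close>)
  have s2: "?s i \<ge> 0" if "i \<in> {Suc j..<n}" for i
    using assms(3)[of i] that by (intro sin_ge_zero) auto
  show "?r \<ge> 0"
    by (intro mult_nonneg_nonneg prod_nonneg) (use s1 s2 in auto)
  have "{..<n} = {..<j} \<union> ({j} \<union> {Suc j..<n})" using assms(1) by auto
  then have "half_sines n t x = (\<Prod>i<j. ?s i) * (?s j * (\<Prod>i\<in>{Suc j..<n}. ?s i))"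
    unfolding half_sines_def by (simp add: prod.union_disjoint disjoint_iff)
  also have "(\<Prod>i<j. ?s i) = (\<Prod>i<j. -1 * - ?s i)" by simp
  also have "\<dots> = (-1) ^ j * (\<Prod>i<j. - ?s i)" unfolding prod.distrib by simp
  finally show "half_sines n t x = (-1) ^ j * ?r * ?s j" by (simp add: mult_ac)
qed

text \<open>Reading \<open>X j\<close>, \<open>y\<close>, \<open>z\<close>, \<open>X (Suc j)\<close>
  in order gives alternating signs, and all later points move by two places, which preserves the
  parity of their index. This contradicts maximality of a tuple of length \<open>n\<close>.\<close>

lemma alternating_points_insert:
  fixes s :: real
  assumes "even n" "j < n" and mono: "\<And>i k. i < k \<Longrightarrow> k \<le> n \<Longrightarrow> X i < X k"
    and Xn: "X n = X 0 + 2 * pi" and s: "\<And>i. i \<le> n \<Longrightarrow> s * (-1) ^ i * f (X i) > 0"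
    and yz: "X j \<le> y" "y < z" "z \<le> X (Suc j)"
    and y: "s * (-1) ^ j * f y < 0" and z: "s * (-1) ^ j * f z > 0"
  shows "\<exists>x. alternating_points f (n + 2) x"
proof -
  define x where "x i = (if i \<le> j then X i else if i = Suc j then y else if i = j + 2 then z else X (i - 2))" for i
  \<comment> \<open>The sign conditions exclude the equalities that \<open>yz\<close> leaves
    open.\<close>
  have "X j \<noteq> y" using s[of j] y assms(2) by auto
  moreover have "X (Suc j) \<noteq> z" using s[of "Suc j"] z assms(2) by auto
  ultimately have y': "X j < y" and z': "z < X (Suc j)" using yz by auto
  have step: "x i < x (Suc i)" if "Suc i < n + 2" for i
  proof -
    consider "i < j" | "i = j" | "i = j + 1" | "i = j + 2" | "i > j + 2" by linarith
    then show ?thesis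
    proof cases
      case 4
      then have "x (Suc i) = X (Suc j)" by (simp add: x_def)
      then show ?thesis using 4 z' by (simp add: x_def)
    next
      case 5
      then show ?thesis using that by (auto simp: x_def intro!: mono)
    qed (use that assms(2) yz y' in \<open>auto simp: x_def intro!: mono\<close>)
  qed
  have x_mono: "x i < x k" if "i < k" "k < n + 2" for i k
    using that
  proof (induction k)
    case (Suc k)
    then show ?case using step[of k] by (cases "i = k") auto
  qed simp
  \<comment> \<open>It suffices to bound the last point: it is \<open>z\<close> if the pair lies in
    the last arc and \<open>X (n - 1)\<close> otherwise, both below \<open>X n\<close>.\<close>
  have lt: "x i < x 0 + 2 * pi" if "i < n + 2" for i
  proof -
    have "x i \<le> x (n + 1)" using x_mono[of i "n + 1"] that by (cases "i = n + 1") auto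
    also have "x (n + 1) < X n"
    proof (cases "Suc j = n")
      case True
      then show ?thesis using z' by (simp add: x_def)
    next
      case False
      then show ?thesis using assms(2) by (auto simp: x_def intro!: mono)
    qed
    finally show ?thesis using Xn by (simp add: x_def)
  qed
  have sgn: "s * (-1) ^ i * f (x i) > 0" if "i < n + 2" for i
  proof -
    consider "i \<le> j" | "i = j + 1" | "i = j + 2" | "i > j + 2" by linarith
    then show ?thesis
    proof cases
      case 4
      define k where "k = i - 2"
      have k: "i = k + 2" "k < n" "x i = X k" using 4 that by (auto simp: k_def x_def)
      show ?thesis using s[of k] k by simp
    qed (use s[of i] assms(2) y z in \<open>auto simp: x_def\<close>)
  qed
  have "alternating_points f (n + 2) x"
    by (rule alternating_pointsI) (use assms(1) x_mono lt sgn in \<open>auto simp: strict_mono_on_def\<close>)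
  then show ?thesis by blast
qed

text \<open>A maximal alternating tuple cuts the circle into \<open>n\<close> arcs. Maximality
  forces a single sign change in each arc, and placing one zero \<open>t j\<close> there makes the
  product follow the sign of \<open>f\<close> up to a global sign.\<close>

lemma sign_changes_half_sines:
  assumes "circle_fun f" "even n" "sign_changes f = enat n"
  obtains s :: real and t where "\<bar>s\<bar> = 1" "\<And>x. s * (f x * half_sines n t x) \<ge> 0"
proof -
  have per: "f (x + 2 * pi) = f x" for x using assms(1) by (simp add: circle_fun_def)
  have no_more: "\<not> alternating_points f (n + 2) x" for x
    using sign_changes_eq_enatD(2)[OF assms(3), of "n + 2" x] by auto
  have "\<exists>s t. s \<noteq> 0 \<and> (\<forall>x. s * (f x * half_sines n t x) \<ge> 0)"
  proof (cases "n = 0")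
    case True
    show ?thesis
    proof (cases "\<exists>a. f a \<noteq> 0")
      case False
      then show ?thesis by (auto intro: exI[of _ 1])
    next
      case ex: True
      then obtain a where a: "f a \<noteq> 0" by blast
      \<comment> \<open>The product of half sines is empty here, so \<open>f\<close> itself must
        keep one sign: a value opposite to \<open>f a\<close>, moved into the period starting at
        \<open>a\<close>, would give two alternating points.\<close>
      have "f a * f y \<ge> 0" for y
      proof (rule ccontr)
        assume *: "\<not> f a * f y \<ge> 0"
        obtain k :: int where k: "a \<le> y + of_int k * (2 * pi)" "y + of_int k * (2 * pi) < a + 2 * pi"
          by (rule shift_into_period[of "2 * pi" a y]) auto
        define b where "b = y + of_int k * (2 * pi)"
        have fb: "f b = f y" unfolding b_def by (rule periodic_int[where g = f]) (rule per)
        then have "a \<noteq> b" using * by auto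
        then have "a < b" using k by (simp add: b_def)
        then have "alternating_points f 2 (\<lambda>i. if i = 0 then a else b)"
          using k a * fb by (intro alternating_pointsI[where s="f a"])
            (auto simp: strict_mono_on_def less_2_cases_iff b_def mult_less_0_iff zero_less_mult_iff not_le)
        then show False using no_more True by (simp add: numeral_2_eq_2)
      qed
      then show ?thesis using a True by (auto simp: half_sines_def intro!: exI[of _ "f a"])
    qed
  next
    case False
    then have n: "n > 0" by simp
    obtain x where x: "alternating_points f n x" using sign_changes_eq_enatD(1)[OF assms(3)] by blast
    define s where "s = f (x 0)"
    \<comment> \<open>Repeating the first point one turn later closes the last arc; since
      \<open>n\<close> is even, the sign pattern extends to the index \<open>n\<close>.\<close>
    define X where "X i = (if i < n then x i else x 0 + 2 * pi)" for i
    have X0: "X 0 = x 0" and Xn: "X n = X 0 + 2 * pi" using n by (auto simp: X_def)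
    have mono: "X i < X k" if "i < k" "k \<le> n" for i k
      using x that by (auto simp: X_def alternating_points_def strict_mono_on_def)
    have mono_le: "X i \<le> X k" if "i \<le> k" "k \<le> n" for i k
      using mono[of i k] that by (cases "i = k") auto
    have s: "s * (-1) ^ i * f (X i) > 0" if "i \<le> n" for i
    proof (cases "i = n")
      case True
      then have "s * (-1) ^ i * f (X i) = s * (-1) ^ 0 * f (x 0)" using assms(2) per by (simp add: X_def)
      also have "\<dots> > 0" unfolding s_def by (rule alternating_points_signD[OF x n])
      finally show ?thesis .
    next
      case False
      then show ?thesis using alternating_points_signD[OF x, of i] that by (simp add: s_def X_def)
    qed
    \<comment> \<open>An opposite sign before \<open>t j\<close> would produce two additional alternating points.\<close>
    define T where "T j = {u \<in> {X j..X (Suc j)}. s * (-1) ^ j * f u > 0}" for j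
    define t where "t j = Sup (T j)" for j
    have T: "X j \<in> T j" "bdd_above (T j)" if "j < n" for j
      using s[of j] mono_le[of j "Suc j"] that by (auto simp: T_def intro: bdd_aboveI[of _ "X (Suc j)"])
    have t_bounds: "X j \<le> t j" "t j \<le> X (Suc j)" if "j < n" for j
      unfolding t_def using T[OF that]
      by (auto intro!: cSup_upper cSup_least) (auto simp: T_def)
    have after: "s * (-1) ^ j * f u \<le> 0" if "j < n" "t j < u" "u \<le> X (Suc j)" for j u
    proof (rule ccontr)
      assume "\<not> ?thesis"
      then have "u \<in> T j" using that t_bounds[of j] by (auto simp: T_def)
      then have "u \<le> t j" unfolding t_def by (rule cSup_upper) (rule T(2)[OF that(1)])
      then show False using that by simp
    qed
    have before: "s * (-1) ^ j * f u \<ge> 0" if j: "j < n" and u: "u < t j" "X j \<le> u" for j u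
    proof (rule ccontr)
      assume *: "\<not> ?thesis"
      obtain z where z: "z \<in> T j" "u < z"
        using u(1) T(1)[OF j] unfolding t_def by (metis empty_iff less_cSupE)
      have "\<exists>x. alternating_points f (n + 2) x"
        by (rule alternating_points_insert[where X = X, OF assms(2) j mono Xn s u(2) z(2)])
          (use z * in \<open>auto simp: T_def\<close>)
      then show False using no_more by simp
    qed
    \<comment> \<open>On arc \<open>j\<close> the other factors contribute the fixed sign
      \<open>(-1) ^ j\<close>, which matches that of the arc; \<open>f\<close> and the factor
      \<open>j\<close> then both switch sign at \<open>t j\<close>. Periodicity extends this from
      one period to the line.\<close>
    have base: "s * (f u * half_sines n t u) \<ge> 0" if u: "X 0 \<le> u" "u \<le> X n" for u
    proof -
      obtain j where j: "j < n" "X j \<le> u" "u \<le> X (Suc j)"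
        using between_consecutive[OF n u] by blast
      have t_range: "X 0 \<le> t i" "t i \<le> X 0 + 2 * pi" if "i < n" for i
        using t_bounds[OF that] mono_le[of 0 i] mono_le[of "Suc i" n] that Xn by auto
      obtain r where r: "r \<ge> 0" "half_sines n t u = (-1) ^ j * r * sin ((t j - u) / 2)"
      proof (rule sign_half_sines[OF j(1)])
        show "t i \<le> u \<and> u \<le> t i + 2 * pi" if "i < j" for i
          using t_bounds(2)[of i] t_range(1)[of i] mono_le[of "Suc i" j] that j u Xn by auto
        show "u \<le> t i \<and> t i \<le> u + 2 * pi" if "j < i" "i < n" for i
          using t_bounds(1)[of i] t_range(2)[of i] mono_le[of "Suc j" i] that j u Xn by auto
      qed
      have "(s * (-1) ^ j * f u) * sin ((t j - u) / 2) \<ge> 0"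
      proof -
        consider "u < t j" | "u = t j" | "t j < u" by linarith
        then show ?thesis
        proof cases
          case 1
          have "sin ((t j - u) / 2) \<ge> 0"
            using 1 t_range(2)[OF j(1)] u by (intro sin_ge_zero) auto
          then show ?thesis using before[OF j(1) 1 j(2)] by simp
        next
          case 3
          have "sin (- ((t j - u) / 2)) \<ge> 0"
            by (rule sin_ge_zero) (use 3 t_range(1)[OF j(1)] u Xn in \<open>simp_all add: field_simps\<close>)
          then show ?thesis using after[OF j(1) 3 j(3)] by (auto intro: mult_nonpos_nonpos)
        qed simp
      qed
      then have "r * ((s * (-1) ^ j * f u) * sin ((t j - u) / 2)) \<ge> 0" using r(1) by simp
      then show ?thesis by (simp add: r(2) mult_ac)
    qed
    have "s * (f u * half_sines n t u) \<ge> 0" for u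
    proof -
      obtain k :: int where k: "X 0 \<le> u + of_int k * (2 * pi)" "u + of_int k * (2 * pi) < X 0 + 2 * pi"
        by (rule shift_into_period[of "2 * pi" "X 0" u]) auto
      have "s * (f (u + of_int k * (2 * pi)) * half_sines n t (u + of_int k * (2 * pi))) = s * (f u * half_sines n t u)"
        by (rule periodic_int[where g = "\<lambda>u. s * (f u * half_sines n t u)"]) (simp add: per half_sines_periodic assms(2))
      with base[OF k(1)] k(2) Xn show ?thesis by simp
    qed
    moreover have "s \<noteq> 0" using s[of 0] by auto
    ultimately show ?thesis by blast
  qed
  then obtain s t where s: "s \<noteq> 0" "\<And>x. s * (f x * half_sines n t x) \<ge> 0" by blast
  show ?thesis
  proof (rule that)
    show "\<bar>sgn s\<bar> = 1" using s(1) by (simp add: sgn_if)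
    show "sgn s * (f x * half_sines n t x) \<ge> 0" for x
      using s(1) s(2)[of x] by (cases "s > 0") (simp_all add: zero_le_mult_iff sgn_if)
  qed
qed

section \<open>Smallness of the products off a small set\<close>

text \<open>Jordan's inequality: by concavity the graph of sine lies above its chord over
  \<open>{0..pi / 2}\<close>.\<close>

lemma half_le_sin:
  fixes y :: real
  assumes "0 \<le> y" "y \<le> pi / 2"
  shows "2 / pi * y \<le> sin y"
proof -
  have "concave_on {0..pi / 2} (sin :: real \<Rightarrow> real)"
  proof (rule f''_le0_imp_concave)
    show "DERIV sin x :> cos x" "DERIV cos x :> - sin x" for x :: real
      by (auto intro!: derivative_eq_intros)
    show "- sin x \<le> 0" if "x \<in> {0..pi / 2}" for x :: real
      using that by (auto intro: sin_ge_zero)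
  qed simp
  from concave_onD_Icc'[OF this, of y] assms show ?thesis by simp
qed

text \<open>The zeros of the factor are \<open>2 * pi\<close> apart. With \<open>v\<close> the zero
  in \<open>[0, 2 * pi)\<close>, every \<open>x\<close> of the period is within \<open>pi\<close> of
  \<open>v\<close> or one of its two neighbours, and Jordan's inequality for half that distance
  bounds it by \<open>pi * \<epsilon>\<close>.\<close>

lemma near_zero_half_sine:
  fixes u :: real
  obtains v where "\<And>x \<epsilon>. x \<in> {0..2 * pi} \<Longrightarrow> \<bar>sin ((u - x) / 2)\<bar> < \<epsilon> \<Longrightarrow>
    x \<in> cball v (pi * \<epsilon>) \<union> cball (v - 2 * pi) (pi * \<epsilon>) \<union> cball (v + 2 * pi) (pi * \<epsilon>)"
proof -
  obtain k :: int where k: "0 \<le> u + of_int k * (2 * pi)" "u + of_int k * (2 * pi) < 0 + 2 * pi"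
    by (rule shift_into_period[of "2 * pi" 0 u]) auto
  define v where "v = u + of_int k * (2 * pi)"
  have small: "\<bar>w\<bar> \<le> pi * \<epsilon>" if "\<bar>sin (w / 2)\<bar> < \<epsilon>" "\<bar>w\<bar> \<le> pi" for w \<epsilon> :: real
  proof -
    have "2 / pi * \<bar>w / 2\<bar> \<le> sin \<bar>w / 2\<bar>"
      by (rule half_le_sin) (use that(2) in auto)
    also have "\<dots> \<le> \<bar>sin (w / 2)\<bar>" by (simp add: abs_if)
    also have "\<dots> \<le> \<epsilon>" using that(1) by simp
    finally show ?thesis by (simp add: pos_divide_le_eq mult.commute)
  qed
  show ?thesis
  proof (rule that[of v])
    fix x \<epsilon> :: real
    assume x: "x \<in> {0..2 * pi}" and "\<bar>sin ((u - x) / 2)\<bar> < \<epsilon>"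
    have "(v - x) / 2 = (u - x) / 2 + of_int k * pi" by (simp add: v_def field_simps)
    then have "\<bar>sin ((v - x) / 2)\<bar> = \<bar>sin ((u - x) / 2)\<bar>"
      using periodic_int[where g = "\<lambda>y. \<bar>sin y\<bar>" and c = pi and k = k]
      by (simp only: sin_periodic_pi abs_minus_cancel)
    then have sin_lt: "\<bar>sin ((v - x) / 2)\<bar> < \<epsilon>" using \<open>\<bar>sin ((u - x) / 2)\<bar> < \<epsilon>\<close> by simp
    have "(v - 2 * pi - x) / 2 = (v - x) / 2 - pi" "(v + 2 * pi - x) / 2 = (v - x) / 2 + pi"
      by (simp_all add: field_simps)
    then have sin_lt': "\<bar>sin ((v - 2 * pi - x) / 2)\<bar> < \<epsilon>" "\<bar>sin ((v + 2 * pi - x) / 2)\<bar> < \<epsilon>"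
      using sin_lt by (simp_all only: sin_diff sin_add) simp_all
    have "- 2 * pi \<le> v - x" "v - x \<le> 2 * pi" using x k by (auto simp: v_def)
    then consider "\<bar>v - x\<bar> \<le> pi" | "\<bar>v - 2 * pi - x\<bar> \<le> pi" | "\<bar>v + 2 * pi - x\<bar> \<le> pi" by linarith
    then show "x \<in> cball v (pi * \<epsilon>) \<union> cball (v - 2 * pi) (pi * \<epsilon>) \<union> cball (v + 2 * pi) (pi * \<epsilon>)"
    proof cases
      case 1
      then show ?thesis using small[OF sin_lt] by (simp add: dist_real_def)
    next
      case 2
      then show ?thesis using small[OF sin_lt'(1)] by (simp add: dist_real_def)
    next
      case 3
      then show ?thesis using small[OF sin_lt'(2)] by (simp add: dist_real_def)
    qed
  qed
qed

text \<open>Three intervals of length \<open>2 * pi * \<epsilon>\<close> cover the set.\<close>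

lemma measure_near_zero_half_sine:
  assumes "\<epsilon> \<ge> 0"
  shows "measure circle_measure {x \<in> {0..2 * pi}. \<bar>sin ((u - x) / 2)\<bar> < \<epsilon>} \<le> 6 * pi * \<epsilon>"
proof -
  obtain v where v: "\<And>x. x \<in> {0..2 * pi} \<Longrightarrow> \<bar>sin ((u - x) / 2)\<bar> < \<epsilon> \<Longrightarrow>
    x \<in> cball v (pi * \<epsilon>) \<union> cball (v - 2 * pi) (pi * \<epsilon>) \<union> cball (v + 2 * pi) (pi * \<epsilon>)"
    by (rule near_zero_half_sine[of u]) blast
  let ?S = "{x \<in> {0..2 * pi}. \<bar>sin ((u - x) / 2)\<bar> < \<epsilon>}"
  let ?B = "\<lambda>c. {c - pi * \<epsilon>..c + pi * \<epsilon>}"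
  have "{x. \<bar>sin ((u - x) / 2)\<bar> < \<epsilon>} \<in> sets borel"
    by measurable
  then have S: "?S \<in> sets lebesgue"
    by (intro sets_completionI_sets) (auto simp: Collect_conj_eq)
  have "measure circle_measure ?S = measure lebesgue ?S"
    by (rule measure_restrict_space) auto
  also have "\<dots> \<le> measure lebesgue (?B v \<union> ?B (v - 2 * pi) \<union> ?B (v + 2 * pi))"
  proof (intro measure_mono_fmeasurable S)
    show "?S \<subseteq> ?B v \<union> ?B (v - 2 * pi) \<union> ?B (v + 2 * pi)"
      using v unfolding cball_eq_atLeastAtMost by blast
  qed auto
  also have "\<dots> \<le> measure lebesgue (?B v \<union> ?B (v - 2 * pi)) + measure lebesgue (?B (v + 2 * pi))"
    by (rule measure_Un_le) auto
  also have "\<dots> \<le> measure lebesgue (?B v) + measure lebesgue (?B (v - 2 * pi)) + measure lebesgue (?B (v + 2 * pi))"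
    by (intro add_right_mono measure_Un_le) auto
  also have "\<dots> = 6 * pi * \<epsilon>"
    using assms by simp
  finally show ?thesis .
qed

text \<open>If some factor is below \<open>\<epsilon>\<close>, the indicator sum is at least 1 and
  the left side is not positive; otherwise every factor is at least \<open>\<epsilon>\<close>. The
  sum of indicators makes the bound linear, ready for integration.\<close>

lemma abs_half_sines_ge:
  assumes "\<epsilon> \<ge> 0"
  shows "\<epsilon> ^ n * (1 - (\<Sum>i<n. indicator {x. \<bar>sin ((t i - x) / 2)\<bar> < \<epsilon>} x)) \<le> \<bar>half_sines n t x\<bar>"
proof (cases "\<exists>i<n. \<bar>sin ((t i - x) / 2)\<bar> < \<epsilon>")
  case True
  then obtain i where i: "i < n" "\<bar>sin ((t i - x) / 2)\<bar> < \<epsilon>" by blast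
  have "1 = (indicator {x. \<bar>sin ((t i - x) / 2)\<bar> < \<epsilon>} x :: real)" using i by simp
  also have "\<dots> \<le> (\<Sum>i<n. indicator {x. \<bar>sin ((t i - x) / 2)\<bar> < \<epsilon>} x)"
    using i by (intro member_le_sum) auto
  finally have "\<epsilon> ^ n * (1 - (\<Sum>i<n. indicator {x. \<bar>sin ((t i - x) / 2)\<bar> < \<epsilon>} x)) \<le> 0"
    using assms by (intro mult_nonneg_nonpos) auto
  then show ?thesis by linarith
next
  case False
  then have "\<epsilon> ^ n * (1 - (\<Sum>i<n. indicator {x. \<bar>sin ((t i - x) / 2)\<bar> < \<epsilon>} x)) = (\<Prod>i<n. \<epsilon>)"
    by simp
  also have "\<dots> \<le> (\<Prod>i<n. \<bar>sin ((t i - x) / 2)\<bar>)"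
    using False assms by (intro prod_mono) force
  finally show ?thesis by (simp add: half_sines_def abs_prod)
qed

section \<open>Norms and the weighted integral from below\<close>

lemma AE_le_Linf_norm:
  assumes f: "continuous_on UNIV f"
  shows "AE x in circle_measure. \<bar>f x\<bar> \<le> Linf_norm f"
proof -
  let ?e = "esssup circle_measure (\<lambda>x. ereal \<bar>f x\<bar>)"
  have meas: "(\<lambda>x. ereal \<bar>f x\<bar>) \<in> borel_measurable circle_measure"
    using integrable_circle_continuous[OF f] by measurable
  \<comment> \<open>\<open>real_of_ereal\<close> sends infinite values to 0, so the essential
    supremum must be shown finite before \<open>Linf_norm\<close> can serve as a bound.\<close>
  have "compact (f ` {0..2 * pi})"
    by (intro compact_continuous_image continuous_on_subset[OF f]) auto
  then obtain M where M: "\<And>x. x \<in> {0..2 * pi} \<Longrightarrow> \<bar>f x\<bar> \<le> M"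
    using compact_imp_bounded[of "f ` {0..2 * pi}"] unfolding bounded_iff image_iff real_norm_def by blast
  have "?e \<le> ereal M"
    using meas M by (intro esssup_I) (auto intro: AE_I2)
  then have top: "?e \<noteq> \<infinity>" by auto
  have AE: "AE x in circle_measure. ereal \<bar>f x\<bar> \<le> ?e" by (rule esssup_AE)
  show ?thesis
  proof (cases "?e = -\<infinity>")
    \<comment> \<open>No real value is at most \<open>-\<infinity>\<close>, so here the
      almost-everywhere bound is contradictory and implies the claim.\<close>
    case True
    then show ?thesis using AE by (auto elim: eventually_mono)
  next
    case False
    then have "?e = ereal (Linf_norm f)" using top by (auto simp: Linf_norm_def ereal_real)
    then show ?thesis using AE by simp
  qed
qed

lemma L1_norm_le_Linf_norm:
  assumes "continuous_on UNIV f"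
  shows "L1_norm f \<le> 2 * pi * Linf_norm f"
proof -
  have "L1_norm f \<le> (\<integral>x. Linf_norm f \<partial>circle_measure)"
    unfolding L1_norm_def
    by (intro integral_mono_AE AE_le_Linf_norm assms integrable_circle_continuous continuous_intros)
  also have "\<dots> = 2 * pi * Linf_norm f"
    by (simp add: measure_restrict_space)
  finally show ?thesis .
qed

text \<open>The pointwise bound is multiplied by \<open>\<bar>f x\<bar>\<close> and integrated; on
  the \<open>n\<close> bad sets \<open>\<bar>f x\<bar>\<close> is replaced by its essential bound,
  each costing at most \<open>6 * pi * \<epsilon>\<close> times \<open>Linf_norm f\<close>.\<close>

lemma integral_abs_half_sines_ge:
  assumes f: "continuous_on UNIV f" and "\<epsilon> \<ge> 0" and B: "Linf_norm f \<ge> 0"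
  shows "\<epsilon> ^ n * (L1_norm f - 6 * pi * real n * \<epsilon> * Linf_norm f) \<le> (\<integral>x. \<bar>f x * half_sines n t x\<bar> \<partial>circle_measure)"
proof -
  let ?Z = "\<lambda>i. {x. \<bar>sin ((t i - x) / 2)\<bar> < \<epsilon>}"
  let ?I = "\<lambda>i. indicator (?Z i) :: real \<Rightarrow> real"
  have Z: "?Z i \<in> sets borel" for i by measurable
  have meas: "{0..2 * pi} \<inter> ?Z i \<in> sets circle_measure" for i
    using Z[of i] by (auto simp: sets_restrict_space intro: sets_completionI_sets)
  interpret finite_measure circle_measure by (rule finite_measure_lebesgue_on) simp
  have intI: "integrable circle_measure (?I i)" for i
    using meas[of i] by (simp add: integrable_indicator_iff Int_commute top.not_eq_extremum[symmetric])
  have measI: "(\<integral>x. ?I i x \<partial>circle_measure) \<le> 6 * pi * \<epsilon>" for i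
  proof -
    have "(\<integral>x. ?I i x \<partial>circle_measure) = measure circle_measure {x \<in> {0..2 * pi}. \<bar>sin ((t i - x) / 2)\<bar> < \<epsilon>}"
      by (simp add: Int_def conj_commute)
    then show ?thesis using measure_near_zero_half_sine[OF assms(2), of "t i"] by simp
  qed
  have intf: "integrable circle_measure (\<lambda>x. \<bar>f x\<bar>)"
    by (intro integrable_circle_continuous continuous_intros f)
  have "\<epsilon> ^ n * (L1_norm f - 6 * pi * real n * \<epsilon> * Linf_norm f) = \<epsilon> ^ n * (L1_norm f - Linf_norm f * (\<Sum>i<n. 6 * pi * \<epsilon>))"
    by (simp add: mult_ac)
  also have "\<dots> \<le> \<epsilon> ^ n * (L1_norm f - Linf_norm f * (\<Sum>i<n. \<integral>x. ?I i x \<partial>circle_measure))"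
    using measI assms(2) B by (intro mult_left_mono diff_left_mono sum_mono) auto
  also have "\<dots> = (\<integral>x. \<epsilon> ^ n * (\<bar>f x\<bar> - Linf_norm f * (\<Sum>i<n. ?I i x)) \<partial>circle_measure)"
    unfolding L1_norm_def using intf intI by simp
  also have "\<dots> \<le> (\<integral>x. \<bar>f x * half_sines n t x\<bar> \<partial>circle_measure)"
  proof (rule integral_mono_AE)
    show "AE x in circle_measure. \<epsilon> ^ n * (\<bar>f x\<bar> - Linf_norm f * (\<Sum>i<n. ?I i x)) \<le> \<bar>f x * half_sines n t x\<bar>"
      using AE_le_Linf_norm[OF f]
    proof eventually_elim
      case (elim x)
      have "\<bar>f x\<bar> * (\<Sum>i<n. ?I i x) \<le> Linf_norm f * (\<Sum>i<n. ?I i x)"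
        using elim by (intro mult_right_mono sum_nonneg) auto
      then have "\<epsilon> ^ n * (\<bar>f x\<bar> - Linf_norm f * (\<Sum>i<n. ?I i x)) \<le> \<epsilon> ^ n * (\<bar>f x\<bar> - \<bar>f x\<bar> * (\<Sum>i<n. ?I i x))"
        using assms(2) by (intro mult_left_mono) auto
      also have "\<dots> = \<bar>f x\<bar> * (\<epsilon> ^ n * (1 - (\<Sum>i<n. ?I i x)))" by (simp add: algebra_simps)
      also have "\<dots> \<le> \<bar>f x\<bar> * \<bar>half_sines n t x\<bar>"
        by (intro mult_left_mono abs_half_sines_ge assms(2)) auto
      finally show ?case by (simp add: abs_mult)
    qed
    show "integrable circle_measure (\<lambda>x. \<bar>f x * half_sines n t x\<bar>)"
      by (intro integrable_circle_continuous continuous_intros f)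
  qed (use intf intI in auto)
  finally show ?thesis .
qed

section \<open>Choice of the scale and conclusion\<close>

theorem theorem2:
  fixes n :: nat
  assumes "even n"
  shows "\<exists>c::real. c > 0 \<and>
    (\<forall>f :: real \<Rightarrow> real.
       circle_fun f \<and> continuous_on UNIV f \<and> (\<exists>x. f x \<noteq> 0) \<and> sign_changes f = enat n \<longrightarrow>
       (\<Sum>k = 0..n div 2. \<bar>circle_inner f (\<lambda>x. sin (real k * x))\<bar>
                        + \<bar>circle_inner f (\<lambda>x. cos (real k * x))\<bar>)
         \<ge> c * (L1_norm f ^ (n + 1) / Linf_norm f ^ n))"
proof -
  \<comment> \<open>\<open>n + 1\<close> instead of \<open>n\<close> keeps \<open>D\<close> positive for \<open>n = 0\<close>.\<close>
  define D where "D = 12 * pi * (real n + 1)"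
  have D: "D > 0" by (simp add: D_def)
  show ?thesis
  proof (intro exI[of _ "1 / (2 * D ^ n)"] conjI allI impI)
    show "1 / (2 * D ^ n) > 0" using D by simp
    fix f assume "circle_fun f \<and> continuous_on UNIV f \<and> (\<exists>x. f x \<noteq> 0) \<and> sign_changes f = enat n"
    then have f: "circle_fun f" "continuous_on UNIV f" "sign_changes f = enat n" by auto
    define S where "S = (\<Sum>k = 0..n div 2. \<bar>circle_inner f (\<lambda>x. sin (real k * x))\<bar>
                        + \<bar>circle_inner f (\<lambda>x. cos (real k * x))\<bar>)"
    define A where "A = L1_norm f"
    define B where "B = Linf_norm f"
    have A: "A \<ge> 0" by (simp add: A_def L1_norm_def)
    have "A \<le> 2 * pi * B" unfolding A_def B_def by (rule L1_norm_le_Linf_norm[OF f(2)])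
    with A have "0 \<le> 2 * pi * B" by linarith
    then have B: "B \<ge> 0" using pi_gt_zero zero_le_mult_iff[of "2 * pi" B] by linarith
    \<comment> \<open>Chosen so that the bad sets cost at most half of \<open>A\<close>; what
      remains is \<open>\<epsilon> ^ n * (A / 2)\<close>, whence the constant
      \<open>1 / (2 * D ^ n)\<close>. For \<open>B = 0\<close> division by zero gives
      \<open>\<epsilon> = 0\<close>, which is consistent with the estimates below.\<close>
    define \<epsilon> where "\<epsilon> = A / (D * B)"
    have \<epsilon>: "\<epsilon> \<ge> 0" using A B D by (simp add: \<epsilon>_def)
    obtain s t where s: "\<bar>s\<bar> = 1" "\<And>x. s * (f x * half_sines n t x) \<ge> 0"
      using sign_changes_half_sines[OF f(1) assms f(3)] by blast
    have small: "6 * pi * real n * \<epsilon> * B \<le> A / 2"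
    proof (cases "B = 0")
      case False
      then have "\<epsilon> * B = A / D" by (simp add: \<epsilon>_def)
      then have "6 * pi * real n * \<epsilon> * B = 6 * pi * real n * (A / D)" by (simp only: mult.assoc)
      also have "\<dots> \<le> D / 2 * (A / D)"
        using A D by (intro mult_right_mono) (auto simp: D_def algebra_simps)
      finally show ?thesis using D by simp
    qed (use A in simp)
    have "1 / (2 * D ^ n) * (A ^ (n + 1) / B ^ n) = \<epsilon> ^ n * (A / 2)"
      by (simp add: \<epsilon>_def power_divide power_mult_distrib mult_ac)
    also have "\<dots> \<le> \<epsilon> ^ n * (A - 6 * pi * real n * \<epsilon> * B)"
      using small \<epsilon> by (intro mult_left_mono) auto
    also have "\<dots> \<le> (\<integral>x. \<bar>f x * half_sines n t x\<bar> \<partial>circle_measure)"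
      using integral_abs_half_sines_ge[OF f(2) \<epsilon>] B by (simp add: A_def B_def)
    also have "\<dots> = (\<integral>x. s * (f x * half_sines n t x) \<partial>circle_measure)"
    proof (intro Bochner_Integration.integral_cong refl)
      fix x
      have "\<bar>f x * half_sines n t x\<bar> = \<bar>s * (f x * half_sines n t x)\<bar>" using s(1) by (simp add: abs_mult)
      then show "\<bar>f x * half_sines n t x\<bar> = s * (f x * half_sines n t x)" using s(2)[of x] by simp
    qed
    also have "\<dots> = s * circle_inner f (half_sines n t)"
      by (simp add: circle_inner_def)
    also have "\<dots> \<le> \<bar>s * circle_inner f (half_sines n t)\<bar>" by simp
    \<comment> \<open>Rewritten as the case of frequency 0 and phase 0 of the Fourier bound;
      evenness turns \<open>2 * (n div 2)\<close> back into \<open>n\<close>.\<close>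
    also have "\<dots> = \<bar>circle_inner f (\<lambda>x. half_sines (2 * (n div 2)) t x * cos (of_int 0 * x + 0))\<bar>"
      using s(1) assms by (simp add: abs_mult)
    also have "\<dots> \<le> S"
      unfolding S_def by (rule inner_half_sines_cos_le[OF f(2)]) simp
    finally show "1 / (2 * D ^ n) * (L1_norm f ^ (n + 1) / Linf_norm f ^ n) \<le> S"
      by (simp add: A_def B_def)
  qed
qed

end
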